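(* If $X$ and $Y$ are bipartite graphs, each on $n\geq 3$ vertices, then $\mathsf{FS}(X,Y)$ is disconnected.
   Context: All graphs are finite and simple. For graphs $X,Y$ with $|V(X)|=|V(Y)|$, the friends-and-strangers graph $\mathsf{FS}(X,Y)$ has as vertices all bijections $\sigma\colon V(X)\to V(Y)$; two bijections $\sigma,\sigma'$ are adjacent iff there is an edge $\{a,b\}\in E(X)$ with $\{\sigma(a),\sigma(b)\}\in E(Y)$, $\sigma(a)=\sigma'(b)$, $\sigma(b)=\sigma'(a)$, and $\sigma(c)=\sigma'(c)$ for all $c\in V(X)\setminus\{a,b\}$. A graph $G$ is bipartite if there is a partition of $V(G)$ into two nonempty sets $A$ and $B$ such that every edge has one endpoint in $A$ and one in $B$. *)

theory Defs
  imports "Graph_Theory.Graph_Theory" "HOL-Library.FuncSet"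
begin

text \<open>
  A finite simple graph is a \<^locale>\<open>pair_graph\<close>: a finite, loop-free, symmetric digraph whose
  arcs are pairs of vertices. The edge \<open>{a, b}\<close> is represented by the two arcs
  \<open>(a, b)\<close> and \<open>(b, a)\<close>.
\<close>

definition bipartite :: "'a pair_pre_digraph \<Rightarrow> bool" where
  "bipartite G \<longleftrightarrow> (\<exists>A B. A \<noteq> {} \<and> B \<noteq> {} \<and> A \<inter> B = {} \<and> A \<union> B = pverts G \<and>
     (\<forall>(u, v) \<in> parcs G. (u \<in> A \<and> v \<in> B) \<or> (u \<in> B \<and> v \<in> A)))"

text \<open>
  Bijections between the vertex sets are functions on the whole type, so they are required to be
  extensional (\<^const>\<open>undefined\<close> outside the vertex set of \<open>X\<close>); this way each bijection is
  represented by exactly one vertex.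
\<close>

definition vertex_bijections ::
    "'a pair_pre_digraph \<Rightarrow> 'b pair_pre_digraph \<Rightarrow> ('a \<Rightarrow> 'b) set" where
  "vertex_bijections X Y =
     {\<sigma> \<in> extensional (pverts X). bij_betw \<sigma> (pverts X) (pverts Y)}"

definition FS ::
    "'a pair_pre_digraph \<Rightarrow> 'b pair_pre_digraph \<Rightarrow> ('a \<Rightarrow> 'b) pair_pre_digraph" where
  "FS X Y = \<lparr> pverts = vertex_bijections X Y,
     parcs = {(\<sigma>, \<sigma>'). \<sigma> \<in> vertex_bijections X Y \<and> \<sigma>' \<in> vertex_bijections X Y \<and>
       (\<exists>a b. (a, b) \<in> parcs X \<and> (\<sigma> a, \<sigma> b) \<in> parcs Y \<and>
          \<sigma> a = \<sigma>' b \<and> \<sigma> b = \<sigma>' a \<and> (\<forall>c \<in> pverts X - {a, b}. \<sigma> c = \<sigma>' c))} \<rparr>"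

lemma finite_vertex_bijections:
  assumes "finite (pverts X)" "finite (pverts Y)"
  shows "finite (vertex_bijections X Y)"
proof (rule finite_subset)
  show "vertex_bijections X Y \<subseteq> (\<Pi>\<^sub>E x \<in> pverts X. pverts Y)"
    by (auto simp: vertex_bijections_def PiE_def bij_betw_def)
  show "finite (\<Pi>\<^sub>E x \<in> pverts X. pverts Y)"
    using assms by (intro finite_PiE) auto
qed

lemma pair_graph_FS:
  assumes "pair_graph X" "pair_graph Y"
  shows "pair_graph (FS X Y)"
proof -
  interpret X: pair_graph X by fact
  interpret Y: pair_graph Y by fact
  have fin: "finite (vertex_bijections X Y)"
    using finite_vertex_bijections X.pair_finite_verts Y.pair_finite_verts by blast
  have sub: "parcs (FS X Y) \<subseteq> vertex_bijections X Y \<times> vertex_bijections X Y"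
    by (auto simp: FS_def)
  have symX: "(b, a) \<in> parcs X" if "(a, b) \<in> parcs X" for a b
    using X.pair_sym_arcs that unfolding symmetric_def with_proj_simps by (rule symD)
  have sym: "(\<sigma>', \<sigma>) \<in> parcs (FS X Y)" if "(\<sigma>, \<sigma>') \<in> parcs (FS X Y)" for \<sigma> \<sigma>'
  proof -
    from that obtain a b where *: "\<sigma> \<in> vertex_bijections X Y" "\<sigma>' \<in> vertex_bijections X Y"
      "(a, b) \<in> parcs X" "(\<sigma> a, \<sigma> b) \<in> parcs Y" "\<sigma> a = \<sigma>' b" "\<sigma> b = \<sigma>' a"
      "\<forall>c \<in> pverts X - {a, b}. \<sigma> c = \<sigma>' c"
      unfolding FS_def pair_pre_digraph.simps mem_Collect_eq case_prod_conv by blast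
    have "(\<sigma>' b, \<sigma>' a) \<in> parcs Y" using *(4-6) by simp
    moreover have "\<forall>c \<in> pverts X - {b, a}. \<sigma>' c = \<sigma> c" using *(7) by force
    ultimately have "\<exists>a b. (a, b) \<in> parcs X \<and> (\<sigma>' a, \<sigma>' b) \<in> parcs Y \<and>
        \<sigma>' a = \<sigma> b \<and> \<sigma>' b = \<sigma> a \<and> (\<forall>c \<in> pverts X - {a, b}. \<sigma>' c = \<sigma> c)"
      using symX[OF *(3)] *(5)[symmetric] *(6)[symmetric] by blast
    with *(1,2) show ?thesis
      unfolding FS_def pair_pre_digraph.simps mem_Collect_eq case_prod_conv by (intro conjI)
  qed
  have irr: "\<sigma> \<noteq> \<sigma>'" if "(\<sigma>, \<sigma>') \<in> parcs (FS X Y)" for \<sigma> \<sigma>'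
  proof -
    from that obtain a b where "(\<sigma> a, \<sigma> b) \<in> parcs Y" "\<sigma> b = \<sigma>' a"
      unfolding FS_def pair_pre_digraph.simps mem_Collect_eq case_prod_conv by blast
    with Y.pair_no_loops show ?thesis by fastforce
  qed
  have vs: "pverts (FS X Y) = vertex_bijections X Y" by (simp add: FS_def)
  show ?thesis
  proof unfold_locales
    show "finite (pverts (FS X Y))" using fin vs by simp
    show "finite (parcs (FS X Y))" using fin sub by (meson finite_SigmaI finite_subset)
    show "symmetric (FS X Y)"
      unfolding symmetric_def with_proj_simps using sym by (rule symI)
    show "fst e \<in> pverts (FS X Y)" "snd e \<in> pverts (FS X Y)" if "e \<in> parcs (FS X Y)" for e
      using that sub unfolding vs by auto
    show "fst e \<noteq> snd e" if "e \<in> parcs (FS X Y)" for e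
      using that irr[of "fst e" "snd e"] by simp
  qed
qed

end

theory Submission
  imports Defs "HOL-Combinatorics.Permutations"
begin

text \<open>
  Let \<open>A, B\<close> be the parts of \<open>X\<close> and \<open>C, D\<close> the parts of \<open>Y\<close>. A move of \<open>FS X Y\<close> composes the
  bijection \<open>\<sigma>\<close> with a transposition of two adjacent vertices of \<open>X\<close>, so it reverses the sign of
  \<open>\<sigma>\<close>. It also exchanges one element of \<open>C\<close> with one of \<open>D\<close> across the two parts of \<open>X\<close>, so the
  number of vertices of \<open>A\<close> sent into \<open>C\<close> changes by exactly one. Hence the sign of \<open>\<sigma>\<close> combined
  with the parity of this number is the same throughout a connected component.

  As \<open>n \<ge> 3\<close>, one part of \<open>X\<close>, say \<open>A\<close>, has two distinct vertices. Composing a bijection with their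
  transposition reverses the sign and leaves the number fixed, so the two bijections
  lie in different components.

  The domain and codomain of \<open>\<sigma>\<close> have different types, so its sign is only meaningful relative to a
  base bijection: \<open>\<sigma>\<close> is written as the base bijection composed with a permutation of the vertices
  of \<open>X\<close>. This relative sign is related to the number along a walk from the base in
  \<open>FS_walk_sign_parity\<close>; the change of the number in one move is \<open>parity_crossing_swap\<close>.
\<close>

lemma bipartiteE:
  assumes "bipartite G"
  obtains A B where "A \<inter> B = {}" "A \<union> B = pverts G"
    "\<forall>u v. (u, v) \<in> parcs G \<longrightarrow> u \<in> A \<and> v \<in> B \<or> u \<in> B \<and> v \<in> A"
proof -
  from assms obtain A B where AB: "A \<inter> B = {}" "A \<union> B = pverts G"
    and arcs: "\<forall>(u, v) \<in> parcs G. u \<in> A \<and> v \<in> B \<or> u \<in> B \<and> v \<in> A"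
    unfolding bipartite_def by (elim exE conjE)
  have "\<forall>u v. (u, v) \<in> parcs G \<longrightarrow> u \<in> A \<and> v \<in> B \<or> u \<in> B \<and> v \<in> A"
    using arcs by (auto dest: bspec)
  with AB show thesis by (rule that)
qed

lemma bipartiteE_large_part:
  assumes "bipartite G" and "finite (pverts G)" and "card (pverts G) \<ge> 3"
  obtains A B where "A \<inter> B = {}" "A \<union> B = pverts G" "card A \<ge> 2"
    "\<forall>u v. (u, v) \<in> parcs G \<longrightarrow> u \<in> A \<and> v \<in> B \<or> u \<in> B \<and> v \<in> A"
proof -
  from assms(1) obtain A B where AB: "A \<inter> B = {}" "A \<union> B = pverts G"
    and arcs: "\<forall>u v. (u, v) \<in> parcs G \<longrightarrow> u \<in> A \<and> v \<in> B \<or> u \<in> B \<and> v \<in> A"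
    by (rule bipartiteE)
  have "finite A" "finite B"
    using assms(2) AB(2) by (metis finite_Un)+
  then have "card A + card B \<ge> 3"
    using assms(3) AB by (metis card_Un_disjoint)
  then consider "card A \<ge> 2" | "card B \<ge> 2"
    by linarith
  then show thesis
  proof cases
    case 1
    show thesis using AB 1 arcs by (rule that)
  next
    case 2
    have BA: "B \<inter> A = {}" "B \<union> A = pverts G"
      using AB by blast+
    have "\<forall>u v. (u, v) \<in> parcs G \<longrightarrow> u \<in> B \<and> v \<in> A \<or> u \<in> A \<and> v \<in> B"
      using arcs by blast
    with BA 2 show thesis by (rule that)
  qed
qed

text \<open>
  Exactly one of \<open>\<sigma> a\<close> and \<open>\<sigma> b\<close> is in \<open>C\<close>, and the swap carries that element of \<open>C\<close> either
  out of the image of \<open>A\<close> or into it; no other vertex of \<open>A\<close> is affected.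
\<close>

lemma parity_crossing_swap:
  assumes "finite A" and "a \<in> A" and "b \<notin> A"
    and "\<sigma> a \<in> C \<longleftrightarrow> \<sigma> b \<notin> C"
    and \<tau>: "\<And>x. x \<in> insert b A \<Longrightarrow> \<tau> x = \<sigma> (Transposition.transpose a b x)"
  shows "even (card {x \<in> A. \<tau> x \<in> C}) \<longleftrightarrow> odd (card {x \<in> A. \<sigma> x \<in> C})"
proof -
  have mem: "\<tau> x \<in> C \<longleftrightarrow> (if x = a then \<sigma> b \<in> C else \<sigma> x \<in> C)" if "x \<in> A" for x
    using \<tau>[of x] that assms(3) by (auto simp: Transposition.transpose_def)
  have fin: "finite {x \<in> A. f x \<in> C}" for f :: "'a \<Rightarrow> 'b"
    using assms(1) by simp
  show ?thesis
  proof (cases "\<sigma> a \<in> C")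
    case True
    then have "{x \<in> A. \<sigma> x \<in> C} = insert a {x \<in> A. \<tau> x \<in> C}" "a \<notin> {x \<in> A. \<tau> x \<in> C}"
      using assms(2,4) by (auto simp: mem split: if_splits)
    then show ?thesis using fin[of \<tau>] by simp
  next
    case False
    then have "{x \<in> A. \<tau> x \<in> C} = insert a {x \<in> A. \<sigma> x \<in> C}" "a \<notin> {x \<in> A. \<sigma> x \<in> C}"
      using assms(2,4) by (auto simp: mem split: if_splits)
    then show ?thesis using fin[of \<sigma>] by simp
  qed
qed

lemma FS_arcE:
  assumes "(\<sigma>, \<tau>) \<in> parcs (FS X Y)"
  obtains a b where "(a, b) \<in> parcs X" "(\<sigma> a, \<sigma> b) \<in> parcs Y"
    "\<And>x. x \<in> pverts X \<Longrightarrow> \<tau> x = \<sigma> (Transposition.transpose a b x)"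
proof -
  from assms obtain a b where ab: "(a, b) \<in> parcs X" "(\<sigma> a, \<sigma> b) \<in> parcs Y"
    "\<sigma> a = \<tau> b" "\<sigma> b = \<tau> a" "\<forall>c \<in> pverts X - {a, b}. \<sigma> c = \<tau> c"
    unfolding FS_def by auto
  have "\<tau> x = \<sigma> (Transposition.transpose a b x)" if "x \<in> pverts X" for x
    using ab(3-5) that by (auto simp: Transposition.transpose_def)
  with ab(1,2) show thesis by (rule that)
qed

text \<open>
  Each step of the walk appends a transposition to \<open>p\<close> and changes the parity of the number of
  vertices of \<open>A\<close> sent into \<open>C\<close>, so \<open>p\<close> is even, and the number has the same parity at both
  ends, exactly when the walk has even length.
\<close>

lemma FS_walk_sign_parity:
  assumes "pair_graph X"
    and X: "A \<inter> B = {}" "A \<union> B = pverts X"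
      "\<forall>u v. (u, v) \<in> parcs X \<longrightarrow> u \<in> A \<and> v \<in> B \<or> u \<in> B \<and> v \<in> A"
    and Y: "C \<inter> D = {}"
      "\<forall>u v. (u, v) \<in> parcs Y \<longrightarrow> u \<in> C \<and> v \<in> D \<or> u \<in> D \<and> v \<in> C"
    and walk: "(\<sigma>, \<tau>) \<in> (parcs (FS X Y))\<^sup>*"
  obtains p where "p permutes pverts X" "\<forall>x \<in> pverts X. \<tau> x = \<sigma> (p x)"
    "evenperm p \<longleftrightarrow> (even (card {x \<in> A. \<tau> x \<in> C}) \<longleftrightarrow> even (card {x \<in> A. \<sigma> x \<in> C}))"
proof -
  interpret X: pair_graph X by fact
  have fin: "finite A" using X(2) X.pair_finite_verts by (metis finite_Un)
  have "\<exists>p. p permutes pverts X \<and> (\<forall>x \<in> pverts X. \<tau> x = \<sigma> (p x)) \<and>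
    (evenperm p \<longleftrightarrow> (even (card {x \<in> A. \<tau> x \<in> C}) \<longleftrightarrow> even (card {x \<in> A. \<sigma> x \<in> C})))"
    using walk
  proof (induction rule: rtrancl_induct)
    case base
    have "(\<lambda>x. x) permutes pverts X" by (simp add: permutes_def)
    then show ?case by (intro exI[of _ "\<lambda>x. x"]) simp
  next
    case (step \<rho> \<tau>)
    then obtain p where p: "p permutes pverts X" "\<forall>x \<in> pverts X. \<rho> x = \<sigma> (p x)"
      "evenperm p \<longleftrightarrow> (even (card {x \<in> A. \<rho> x \<in> C}) \<longleftrightarrow> even (card {x \<in> A. \<sigma> x \<in> C}))"
      by blast
    from step.hyps(2) obtain a b where ab: "(a, b) \<in> parcs X" "(\<rho> a, \<rho> b) \<in> parcs Y"
      "\<And>x. x \<in> pverts X \<Longrightarrow> \<tau> x = \<rho> (Transposition.transpose a b x)"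
      by (rule FS_arcE) blast
    let ?t = "Transposition.transpose a b"
    have ne: "a \<noteq> b" and V: "a \<in> pverts X" "b \<in> pverts X"
      using X(1,2) X(3)[rule_format, OF ab(1)] by auto
    have t: "?t permutes pverts X" using V by (rule permutes_swap_id)
    have cross: "\<rho> a \<in> C \<longleftrightarrow> \<rho> b \<notin> C" using Y ab(2) by blast
    have flip: "even (card {x \<in> A. \<tau> x \<in> C}) \<longleftrightarrow> odd (card {x \<in> A. \<rho> x \<in> C})"
    proof (cases "a \<in> A")
      case True
      then show ?thesis
        using X(1,2) X(3)[rule_format, OF ab(1)] cross ab(3) fin
        by (intro parity_crossing_swap[where a = a and b = b]) auto
    next
      case False
      then show ?thesis
        using X(1,2) X(3)[rule_format, OF ab(1)] cross ab(3) fin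
        by (intro parity_crossing_swap[where a = b and b = a]) (auto simp: transpose_commute[of b a])
    qed
    have flip_sign: "evenperm (p \<circ> ?t) \<longleftrightarrow> \<not> evenperm p"
      using permutes_imp_permutation[OF X.pair_finite_verts p(1)] ne
      by (simp add: evenperm_comp permutation_swap_id evenperm_swap)
    have "evenperm (p \<circ> ?t) \<longleftrightarrow>
        (even (card {x \<in> A. \<tau> x \<in> C}) \<longleftrightarrow> even (card {x \<in> A. \<sigma> x \<in> C}))"
      unfolding flip_sign flip p(3) by blast
    moreover have "(p \<circ> ?t) permutes pverts X" using t p(1) by (rule permutes_compose)
    moreover have "\<tau> x = \<sigma> ((p \<circ> ?t) x)" if "x \<in> pverts X" for x
      using that ab(3) p(2) permutes_in_image[OF t] by simp
    ultimately show ?case by blast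
  qed
  then show thesis using that by blast
qed

lemma connected_pair_graph_rtrancl:
  assumes "pair_graph G" and "Digraph_Component.connected (with_proj G)"
    and "u \<in> pverts G" and "v \<in> pverts G"
  shows "(u, v) \<in> (parcs G)\<^sup>*"
proof -
  interpret G: pair_graph G by fact
  have "strongly_connected (with_proj G)"
    using G.pair_sym_arcs assms(2) by (rule G.symmetric_connected_imp_strongly_connected)
  then have "u \<rightarrow>\<^sup>*\<^bsub>with_proj G\<^esub> v"
    using assms(3,4) by (simp add: strongly_connected_def)
  from reachable_rtranclI[OF this] show ?thesis by (simp add: arcs_ends_def)
qed

lemma ex_vertex_bijection:
  assumes "finite (pverts X)" "finite (pverts Y)" "card (pverts X) = card (pverts Y)"
  obtains \<sigma> where "\<sigma> \<in> vertex_bijections X Y"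
proof -
  from assms obtain f where "bij_betw f (pverts X) (pverts Y)"
    by (metis finite_same_card_bij)
  then have "restrict f (pverts X) \<in> vertex_bijections X Y"
    by (simp add: vertex_bijections_def bij_betw_restrict_eq)
  then show thesis by (rule that)
qed

theorem proposition2p7:
  fixes X :: "'a pair_pre_digraph" and Y :: "'b pair_pre_digraph" and n :: nat
  assumes "pair_graph X" and "pair_graph Y"
    and "card (pverts X) = n" and "card (pverts Y) = n" and "n \<ge> 3"
    and "bipartite X" and "bipartite Y"
  shows "\<not> Digraph_Component.connected (with_proj (FS X Y))"
proof
  assume conn: "Digraph_Component.connected (with_proj (FS X Y))"
  interpret X: pair_graph X by fact
  interpret Y: pair_graph Y by fact
  have large: "card (pverts X) \<ge> 3" using assms(3,5) by simp
  obtain A B where X: "A \<inter> B = {}" "A \<union> B = pverts X" "card A \<ge> 2"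
    "\<forall>u v. (u, v) \<in> parcs X \<longrightarrow> u \<in> A \<and> v \<in> B \<or> u \<in> B \<and> v \<in> A"
    by (rule bipartiteE_large_part[OF assms(6) X.pair_finite_verts large])
  obtain C D where Y: "C \<inter> D = {}"
    "\<forall>u v. (u, v) \<in> parcs Y \<longrightarrow> u \<in> C \<and> v \<in> D \<or> u \<in> D \<and> v \<in> C"
    using assms(7) by (rule bipartiteE)
  obtain S where "S \<subseteq> A" "card S = 2"
    using X(3) by (rule obtain_subset_with_card_n)
  then obtain a b where ab: "a \<in> A" "b \<in> A" "a \<noteq> b"
    by (auto simp: card_2_iff)
  let ?t = "Transposition.transpose a b"
  have V: "a \<in> pverts X" "b \<in> pverts X" using ab X(2) by blast+
  have t: "?t permutes pverts X" using V by (rule permutes_swap_id)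
  have tA: "?t permutes A" using ab(1,2) by (rule permutes_swap_id)
  obtain \<sigma> where \<sigma>: "\<sigma> \<in> vertex_bijections X Y"
    using ex_vertex_bijection[OF X.pair_finite_verts Y.pair_finite_verts] assms(3,4) by metis
  then have bij: "bij_betw \<sigma> (pverts X) (pverts Y)"
    by (simp add: vertex_bijections_def)
  define \<tau> where "\<tau> = restrict (\<sigma> \<circ> ?t) (pverts X)"
  have \<tau>: "\<tau> \<in> vertex_bijections X Y"
    using bij_betw_trans[OF permutes_imp_bij[OF t] bij]
    by (simp add: \<tau>_def vertex_bijections_def bij_betw_restrict_eq)
  have "(\<sigma>, \<tau>) \<in> (parcs (FS X Y))\<^sup>*"
    using connected_pair_graph_rtrancl[OF pair_graph_FS[OF assms(1,2)] conn] \<sigma> \<tau>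
    by (simp add: FS_def)
  then obtain p where p: "p permutes pverts X" "\<forall>x \<in> pverts X. \<tau> x = \<sigma> (p x)"
    "evenperm p \<longleftrightarrow> (even (card {x \<in> A. \<tau> x \<in> C}) \<longleftrightarrow> even (card {x \<in> A. \<sigma> x \<in> C}))"
    by (rule FS_walk_sign_parity[OF assms(1) X(1,2,4) Y])
  \<comment> \<open>As \<open>\<sigma>\<close> is injective, \<open>p\<close> depends only on \<open>\<sigma>\<close> and \<open>\<tau>\<close>; so \<open>p\<close> is odd although the
    number of vertices of \<open>A\<close> sent into \<open>C\<close> is the same at both ends.\<close>
  have "p x = ?t x" for x
  proof (cases "x \<in> pverts X")
    case True
    then have "\<sigma> (p x) = \<sigma> (?t x)" using p(2) by (simp add: \<tau>_def)
    moreover have "p x \<in> pverts X" "?t x \<in> pverts X"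
      using True permutes_in_image[OF p(1)] permutes_in_image[OF t] by blast+
    ultimately show ?thesis using bij by (meson bij_betw_imp_inj_on inj_onD)
  next
    case False
    then show ?thesis using p(1) t by (simp add: permutes_not_in)
  qed
  then have "p = ?t" by (rule ext)
  then have "\<not> evenperm p" using ab(3) by (simp add: evenperm_swap)
  moreover have "card {x \<in> A. \<tau> x \<in> C} = card {x \<in> A. \<sigma> x \<in> C}"
  proof (rule bij_betw_same_card)
    have "\<tau> x = \<sigma> (?t x)" if "x \<in> A" for x
      using that X(2) by (auto simp: \<tau>_def)
    moreover have "?t x \<in> A" if "x \<in> A" for x
      using that permutes_in_image[OF tA] by simp
    ultimately show "bij_betw ?t {x \<in> A. \<tau> x \<in> C} {x \<in> A. \<sigma> x \<in> C}"
      by (intro bij_betw_byWitness[where f' = ?t]) auto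
  qed
  ultimately show False using p(3) by simp
qed

end
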